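(* Let $S$ be a subspace of $H$ with $\dim S=r<\infty$. The following sets all coincide with the moment $m_S$ of $S$ relative to the basis $E$ (identifying diagonal trace-class operators with sequences in $\ell^1(\mathbb{R})$): (a) $\operatorname{Diag}(\mathcal{D}_S)$; (b) $\operatorname{conv}\{|v|^2: v\in S,\ \|v\|=1\}$; (c) $\bigcup_{\{s^i\}_{i=1}^r\ \text{orthonormal set in } S}\operatorname{conv}\{|s^i|^2\}_{i=1}^r$; (d) $\{(\operatorname{tr}(E_1Y),\dots,\operatorname{tr}(E_nY),\dots)\in\ell^1(\mathbb{R}): Y\in\mathcal{D}_S\}$; (e) $W(P_SE_1P_S,\dots,P_SE_nP_S,\dots)\cap\{x\in\ell^1(\mathbb{R}): x_i\ge0 \text{ for all } i \text{ and } \sum_{i=1}^\infty x_i=1\}$.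
   Context: $H$ is a complex separable infinite dimensional Hilbert space with a fixed orthonormal basis $E=\{e_j\}_{j=1}^\infty$; $E_j=e_j\otimes e_j$ is the rank-one orthogonal projection onto $\mathrm{span}\{e_j\}$; $P_S$ is the orthogonal projection onto $S$; $\mathcal{B}_1(H)$ is the space of trace-class operators. $\mathcal{D}_S=\{Y\in\mathcal{B}_1(H):P_SY=Y\ge0,\ \operatorname{tr}(Y)=1\}$. $\operatorname{Diag}(K)$ is the diagonal operator with the same diagonal as $K$ in the basis $E$, identified with the sequence $(\langle Ke_j,e_j\rangle)_j$. By definition $m_S=\operatorname{Diag}(\mathcal{D}_S)$. For $v\in H$, $|v|^2=(|\langle v,e_1\rangle|^2,|\langle v,e_2\rangle|^2,\dots)$. $\operatorname{conv}$ is the (algebraic) convex hull. For a norm-bounded sequence $\mathbf{A}=\{A_j\}_{j=1}^\infty$ of self-adjoint compact operators, the joint numerical range is $W(\mathbf{A})=\{\{\operatorname{tr}(\rho A_j)\}_{j=1}^\infty:\rho\in\mathcal{B}_1(H),\ \rho\ge0,\ \operatorname{tr}(\rho)=1\}$. *)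

theory Defs
  imports
    "HOL-Analysis.Analysis"
    "HOL-Library.Function_Algebras"
    "HOL-Library.Nonpos_Ints"
begin

section \<open>Complex Hilbert spaces\<close>

text \<open>The underlying real inner product is the real part of the complex one, so the norm is
  \<open>sqrt (Re (cinner x x))\<close>. The complex inner product is linear in its first argument.\<close>

class complex_inner = real_inner +
  fixes scaleC :: "complex \<Rightarrow> 'a \<Rightarrow> 'a"  (infixr \<open>*\<^sub>C\<close> 75)
    and cinner :: "'a \<Rightarrow> 'a \<Rightarrow> complex"
  assumes scaleC_add_right: "a *\<^sub>C (x + y) = a *\<^sub>C x + a *\<^sub>C y"
    and scaleC_add_left: "(a + b) *\<^sub>C x = a *\<^sub>C x + b *\<^sub>C x"
    and scaleC_scaleC: "a *\<^sub>C (b *\<^sub>C x) = (a * b) *\<^sub>C x"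
    and scaleC_of_real: "complex_of_real c *\<^sub>C x = c *\<^sub>R x"
    and cinner_commute: "cinner x y = cnj (cinner y x)"
    and cinner_add_left: "cinner (x + y) z = cinner x z + cinner y z"
    and cinner_scaleC_left: "cinner (a *\<^sub>C x) y = a * cinner x y"
    and inner_eq_Re_cinner: "inner x y = Re (cinner x y)"

class chilbert_space = complex_inner + complete_space

global_interpretation complex_vector: vector_space "scaleC :: complex \<Rightarrow> 'a \<Rightarrow> 'a::complex_inner"
  defines csubspace = complex_vector.subspace
    and cspan = complex_vector.span
    and cdim = complex_vector.dim
proof unfold_locales
  show "1 *\<^sub>C x = x" for x :: 'a
    using scaleC_of_real[of 1 x] by simp
qed (simp_all add: scaleC_add_right scaleC_add_left scaleC_scaleC)

definition orthonormal_on :: "'i set \<Rightarrow> ('i \<Rightarrow> 'a::complex_inner) \<Rightarrow> bool" where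
  "orthonormal_on I s \<longleftrightarrow> (\<forall>i\<in>I. \<forall>j\<in>I. cinner (s i) (s j) = (if i = j then 1 else 0))"

text \<open>The existence of such a sequence makes the space separable and infinite dimensional.\<close>

definition orthonormal_basis :: "(nat \<Rightarrow> 'a::complex_inner) \<Rightarrow> bool" where
  "orthonormal_basis e \<longleftrightarrow> orthonormal_on UNIV e \<and> closure (cspan (range e)) = UNIV"

section \<open>Operators\<close>

definition bounded_clinear :: "('a::complex_inner \<Rightarrow> 'a) \<Rightarrow> bool" where
  "bounded_clinear T \<longleftrightarrow> bounded_linear T \<and> (\<forall>c x. T (c *\<^sub>C x) = c *\<^sub>C T x)"

definition positive_op :: "('a::complex_inner \<Rightarrow> 'a) \<Rightarrow> bool" where
  "positive_op T \<longleftrightarrow> bounded_clinear T \<and> (\<forall>x. cinner (T x) x \<in> \<real>\<^sub>\<ge>\<^sub>0)"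

definition cadjoint :: "('a::complex_inner \<Rightarrow> 'a) \<Rightarrow> ('a \<Rightarrow> 'a)" where
  "cadjoint T = (THE T'. \<forall>x y. cinner (T x) y = cinner x (T' y))"

definition proj :: "'a::complex_inner set \<Rightarrow> 'a \<Rightarrow> 'a" where
  "proj S x = (THE p. p \<in> S \<and> (\<forall>y\<in>S. cinner (x - p) y = 0))"

definition rank_one :: "'a::complex_inner \<Rightarrow> 'a \<Rightarrow> ('a \<Rightarrow> 'a)" where
  "rank_one x y = (\<lambda>v. cinner v y *\<^sub>C x)"

text \<open>In the next definition \<open>R\<close> is \<open>\<bar>T\<bar>\<close>, the positive square root of \<open>T\<^sup>*T\<close>
  (it exists and is unique for every bounded \<open>T\<close>). Neither the trace class nor the trace
  depends on the orthonormal basis \<open>e\<close>.\<close>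

definition trace_class :: "(nat \<Rightarrow> 'a::chilbert_space) \<Rightarrow> ('a \<Rightarrow> 'a) \<Rightarrow> bool" where
  "trace_class e T \<longleftrightarrow> bounded_clinear T \<and>
     (\<exists>R. positive_op R \<and> R \<circ> R = cadjoint T \<circ> T \<and> summable (\<lambda>j. cinner (R (e j)) (e j)))"

definition op_trace :: "(nat \<Rightarrow> 'a::chilbert_space) \<Rightarrow> ('a \<Rightarrow> 'a) \<Rightarrow> complex" where
  "op_trace e T = (\<Sum>j. cinner (T (e j)) (e j))"

definition density_ops :: "(nat \<Rightarrow> 'a::chilbert_space) \<Rightarrow> 'a set \<Rightarrow> ('a \<Rightarrow> 'a) set" where
  "density_ops e S = {Y. trace_class e Y \<and> proj S \<circ> Y = Y \<and> positive_op Y \<and> op_trace e Y = 1}"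

section \<open>Sequences\<close>

text \<open>Pointwise real vector space structure on functions, so that the library's algebraic
  convex hull applies to sequences.\<close>

instantiation "fun" :: (type, real_vector) real_vector
begin

definition scaleR_fun :: "real \<Rightarrow> ('a \<Rightarrow> 'b) \<Rightarrow> 'a \<Rightarrow> 'b" where
  "scaleR_fun c f = (\<lambda>x. c *\<^sub>R f x)"

instance
  by standard (auto simp: scaleR_fun_def fun_eq_iff scaleR_add_right scaleR_add_left)

end

text \<open>All sequences are complex valued, because diagonal entries and traces are complex numbers;
  \<open>\<ell>\<^sup>1(\<real>)\<close> is the set of absolutely summable sequences with real entries.\<close>

definition ell1_real :: "(nat \<Rightarrow> complex) set" where
  "ell1_real = {x. (\<forall>j. x j \<in> \<real>) \<and> summable (\<lambda>j. norm (x j))}"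

text \<open>A diagonal operator is identified with the sequence of its diagonal entries.\<close>

definition Diag :: "(nat \<Rightarrow> 'a::chilbert_space) \<Rightarrow> ('a \<Rightarrow> 'a) \<Rightarrow> nat \<Rightarrow> complex" where
  "Diag e K = (\<lambda>j. cinner (K (e j)) (e j))"

definition moment :: "(nat \<Rightarrow> 'a::chilbert_space) \<Rightarrow> 'a set \<Rightarrow> (nat \<Rightarrow> complex) set" where
  "moment e S = Diag e ` density_ops e S"

definition sq_coeffs :: "(nat \<Rightarrow> 'a::chilbert_space) \<Rightarrow> 'a \<Rightarrow> nat \<Rightarrow> complex" where
  "sq_coeffs e v = (\<lambda>j. complex_of_real ((cmod (cinner v (e j)))\<^sup>2))"

definition joint_numerical_range ::
    "(nat \<Rightarrow> 'a::chilbert_space) \<Rightarrow> (nat \<Rightarrow> 'a \<Rightarrow> 'a) \<Rightarrow> (nat \<Rightarrow> complex) set" where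
  "joint_numerical_range e A =
     {(\<lambda>j. op_trace e (\<rho> \<circ> A j)) |\<rho>. trace_class e \<rho> \<and> positive_op \<rho> \<and> op_trace e \<rho> = 1}"

end

theory Submission
  imports Defs
begin

text \<open>
  Everything rests on one fact: a density operator \<open>Y\<close> with range in the finite-dimensional
  subspace \<open>S\<close> is diagonal in some orthonormal basis \<open>s\<^sub>1, \<dots>, s\<^sub>r\<close> of \<open>S\<close>. Its eigenvalues
  \<open>u\<^sub>i\<close> are nonnegative and, by Parseval's identity, sum to the trace \<open>1\<close>; hence the diagonal of
  \<open>Y\<close> is the convex combination \<open>\<Sum>\<^sub>i u\<^sub>i |s\<^sub>i|\<^sup>2\<close> of the squared coordinate sequences of one
  orthonormal frame (\<open>moment_subset_hull_of_frame\<close>). Such a combination lies in the hull of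
  all \<open>|v|\<^sup>2\<close> with \<open>v\<close> a unit vector of \<open>S\<close>. The circle closes because \<open>|v|\<^sup>2\<close> is the diagonal of
  the density operator \<open>v \<otimes> v\<close> and the moment is convex.

  The joint numerical range enters through cyclicity of the trace, which for the rank-one
  operator \<open>P E\<^sub>j P\<close> is Parseval's identity:
  \<open>tr (\<rho> P E\<^sub>j P) = \<langle>P \<rho> P e\<^sub>j, e\<^sub>j\<rangle>\<close>. So its points are the diagonals of the compressions
  \<open>P \<rho> P\<close>, positive operators with range in \<open>S\<close>, and demanding that the diagonal sums to \<open>1\<close>
  says exactly that the compression is a density operator.

  A positive operator is self-adjoint, so it is its own absolute value. Together with the finite
  rank this reduces membership in \<open>density_ops\<close> to positivity, range in \<open>S\<close> and diagonal sum \<open>1\<close>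
  (\<open>density_ops_iff\<close>).

  The diagonalisation is variational: an eigenvector is a maximiser of the quadratic form on the
  compact unit sphere of \<open>S\<close>, or of the part of \<open>S\<close> orthogonal to the eigenvectors already
  found, and a maximal orthonormal set of eigenvectors must span \<open>S\<close>.
\<close>

section \<open>The complex inner product\<close>

lemma cinner_zero_left [simp]: "cinner 0 (x::'a::complex_inner) = 0"
  using cinner_add_left[of 0 0 x] by simp

lemma cinner_zero_right [simp]: "cinner (x::'a::complex_inner) 0 = 0"
  by (subst cinner_commute) simp

lemma cinner_add_right: "cinner (x::'a::complex_inner) (y + z) = cinner x y + cinner x z"
  by (metis cinner_commute cinner_add_left complex_cnj_add)

lemma cinner_scaleC_right: "cinner (x::'a::complex_inner) (a *\<^sub>C y) = cnj a * cinner x y"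
  by (metis cinner_commute cinner_scaleC_left complex_cnj_mult)

lemma cinner_scaleR_left: "cinner (a *\<^sub>R x) (y::'a::complex_inner) = a * cinner x y"
  by (metis cinner_scaleC_left scaleC_of_real)

lemma cinner_minus_left: "cinner (- x) (y::'a::complex_inner) = - cinner x y"
  using cinner_scaleR_left[of "-1" x y] by simp

lemma cinner_diff_left: "cinner (x - y) (z::'a::complex_inner) = cinner x z - cinner y z"
  using cinner_add_left[of x "-y" z] by (simp add: cinner_minus_left)

lemma cinner_sum_left: "cinner (\<Sum>i\<in>I. f i) (y::'a::complex_inner) = (\<Sum>i\<in>I. cinner (f i) y)"
  by (induction I rule: infinite_finite_induct) (auto simp: cinner_add_left)

lemma cinner_sum_right: "cinner (x::'a::complex_inner) (\<Sum>i\<in>I. f i) = (\<Sum>i\<in>I. cinner x (f i))"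
  by (induction I rule: infinite_finite_induct) (auto simp: cinner_add_right)

lemma cinner_self: "cinner x x = complex_of_real ((norm (x::'a::complex_inner))\<^sup>2)"
proof -
  have "Im (cinner x x) = 0"
    using arg_cong[OF cinner_commute[of x x], of Im] by simp
  then show ?thesis
    by (simp add: complex_eq_iff dot_square_norm inner_eq_Re_cinner[symmetric])
qed

lemma cinner_self_eq_0_iff [simp]: "cinner x x = 0 \<longleftrightarrow> (x::'a::complex_inner) = 0"
  by (simp add: cinner_self)

lemma cinner_ext: "(\<And>y. cinner x y = cinner z y) \<Longrightarrow> x = (z::'a::complex_inner)"
  using cinner_self_eq_0_iff[of "x - z"] by (metis cinner_diff_left eq_iff_diff_eq_0)

lemma norm_eq_1_iff_cinner: "norm (x::'a::complex_inner) = 1 \<longleftrightarrow> cinner x x = 1"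
proof
  assume "cinner x x = 1"
  then have "complex_of_real ((norm x)\<^sup>2) = complex_of_real 1" by (simp add: cinner_self)
  then have "(norm x)\<^sup>2 = 1" by (simp only: of_real_eq_iff)
  then show "norm x = 1"
    by (simp add: power2_eq_1_iff) (smt (verit) norm_ge_zero)
qed (simp add: cinner_self)

lemma norm_scaleC: "norm (c *\<^sub>C x) = cmod c * norm (x::'a::complex_inner)"
proof -
  have "complex_of_real ((norm (c *\<^sub>C x))\<^sup>2) = complex_of_real ((cmod c * norm x)\<^sup>2)"
    unfolding cinner_self[symmetric] cinner_scaleC_left cinner_scaleC_right power_mult_distrib
      of_real_mult complex_norm_square by simp
  then have "(norm (c *\<^sub>C x))\<^sup>2 = (cmod c * norm x)\<^sup>2" by (simp only: of_real_eq_iff)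
  then show ?thesis by (simp add: power2_eq_iff_nonneg)
qed

lemma cmod_cinner_le: "cmod (cinner x y) \<le> norm x * norm (y::'a::complex_inner)"
proof (cases "cinner x y = 0")
  case False
  \<comment> \<open>a phase rotating \<open>cinner x y\<close> onto the positive real axis\<close>
  define c where "c = cnj (sgn (cinner x y))"
  have c: "cmod c = 1" using False by (simp add: c_def norm_sgn)
  have "c * cinner x y = c * cnj c * complex_of_real (cmod (cinner x y))"
    using False by (simp add: c_def sgn_eq)
  also have "\<dots> = complex_of_real (cmod (cinner x y))"
    using c by (simp add: complex_norm_square[symmetric])
  finally have "cmod (cinner x y) = inner (c *\<^sub>C x) y"
    by (simp add: inner_eq_Re_cinner cinner_scaleC_left)
  also have "\<dots> \<le> norm (c *\<^sub>C x) * norm y" by (rule norm_cauchy_schwarz)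
  finally show ?thesis by (simp add: norm_scaleC c)
qed simp

lemma bounded_linear_cinner_left: "bounded_linear (\<lambda>x. cinner x (y::'a::complex_inner))"
  by (rule bounded_linear_intro[where K = "norm y"])
    (auto simp: cinner_add_left cinner_scaleR_left scaleR_conv_of_real cmod_cinner_le)

lemma bounded_linear_scaleC_left: "bounded_linear (\<lambda>c. c *\<^sub>C (x::'a::complex_inner))"
proof (rule bounded_linear_intro[where K = "norm x"])
  show "(t *\<^sub>R c) *\<^sub>C x = t *\<^sub>R (c *\<^sub>C x)" for t c
    by (simp only: scaleR_conv_of_real scaleC_of_real[symmetric] scaleC_scaleC)
qed (simp_all only: scaleC_add_left norm_scaleC order.refl)

section \<open>Orthonormal expansions\<close>

text \<open>For an orthonormal family, \<open>expansion I s\<close> is the orthogonal projection onto the span of the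
  family. It serves both as the projection onto \<open>S\<close> and, with \<open>I = {..<n}\<close>, as a partial sum of the
  Fourier series with respect to \<open>e\<close>.\<close>

definition expansion :: "'i set \<Rightarrow> ('i \<Rightarrow> 'a) \<Rightarrow> 'a \<Rightarrow> 'a::complex_inner" where
  "expansion I s x = (\<Sum>i\<in>I. cinner x (s i) *\<^sub>C s i)"

lemma expansion_in_span: "expansion I s x \<in> cspan (s ` I)"
  unfolding expansion_def
  by (intro complex_vector.span_sum complex_vector.span_scale complex_vector.span_base imageI)

lemma cinner_expansion:
  assumes "orthonormal_on I s" "finite I" "i \<in> I"
  shows "cinner (expansion I s x) (s i) = cinner x (s i)"
proof -
  have "cinner (expansion I s x) (s i) = (\<Sum>k\<in>I. if k = i then cinner x (s i) else 0)"
    unfolding expansion_def cinner_sum_left cinner_scaleC_left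
    using assms by (intro sum.cong) (auto simp: orthonormal_on_def)
  then show ?thesis using assms by simp
qed

lemma orthogonal_to_span:
  assumes "\<And>b. b \<in> B \<Longrightarrow> cinner x b = 0" "y \<in> cspan B"
  shows "cinner x (y::'a::complex_inner) = 0"
  using assms(2)
  by (induction rule: complex_vector.span_induct)
    (auto simp: complex_vector.subspace_def cinner_add_right cinner_scaleC_right assms(1))

lemma diff_expansion_orthogonal:
  assumes "orthonormal_on I s" "finite I" "y \<in> cspan (s ` I)"
  shows "cinner (x - expansion I s x) y = 0"
  by (rule orthogonal_to_span[OF _ assms(3)]) (auto simp: cinner_diff_left cinner_expansion assms)

lemma expansion_eq_self:
  assumes "orthonormal_on I s" "finite I" "y \<in> cspan (s ` I)"
  shows "expansion I s y = y"
proof -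
  have "y - expansion I s y \<in> cspan (s ` I)"
    by (intro complex_vector.span_diff assms expansion_in_span)
  from diff_expansion_orthogonal[OF assms(1,2) this, of y] show ?thesis by simp
qed

text \<open>Best approximation, by Pythagoras: \<open>x - expansion I s x\<close> is orthogonal to the span, which
  contains \<open>expansion I s x - y\<close>.\<close>

lemma norm_diff_expansion_le:
  assumes "orthonormal_on I s" "finite I" "y \<in> cspan (s ` I)"
  shows "norm (x - expansion I s x) \<le> norm (x - y)"
proof -
  let ?p = "expansion I s x"
  have "inner (x - ?p) (?p - y) = 0"
    unfolding inner_eq_Re_cinner
    by (subst diff_expansion_orthogonal)
      (auto intro!: complex_vector.span_diff assms expansion_in_span)
  then have "(norm ((x - ?p) + (?p - y)))\<^sup>2 = (norm (x - ?p))\<^sup>2 + (norm (?p - y))\<^sup>2"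
    by (rule norm_add_Pythagorean[unfolded orthogonal_def])
  then have "(norm (x - ?p))\<^sup>2 \<le> (norm (x - y))\<^sup>2" by simp
  then show ?thesis by (simp add: power2_le_iff_abs_le)
qed

lemma proj_eq_expansion:
  assumes "orthonormal_on I s" "finite I" "cspan (s ` I) = S"
  shows "proj S x = expansion I s x"
  unfolding proj_def
proof (rule the_equality)
  show "expansion I s x \<in> S \<and> (\<forall>y\<in>S. cinner (x - expansion I s x) y = 0)"
    using assms diff_expansion_orthogonal expansion_in_span by blast
next
  fix p assume p: "p \<in> S \<and> (\<forall>y\<in>S. cinner (x - p) y = 0)"
  have d: "expansion I s x - p \<in> S"
    using p assms(3) expansion_in_span[of I s x] complex_vector.span_diff by blast
  then have "cinner (x - p) (expansion I s x - p) = 0"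
    "cinner (x - expansion I s x) (expansion I s x - p) = 0"
    using p diff_expansion_orthogonal[OF assms(1,2)] assms(3) by auto
  then have "cinner ((x - p) - (x - expansion I s x)) (expansion I s x - p) = 0"
    by (simp only: cinner_diff_left[of "x - p" "x - expansion I s x"] diff_zero)
  then show "p = expansion I s x" by simp
qed

text \<open>Finite combinations of the \<open>e j\<close> come arbitrarily close to \<open>x\<close>, and as soon as \<open>n\<close> exceeds the
  indices of such a combination, the \<open>n\<close>-th partial sum is at least as close.\<close>

lemma expansion_tendsto:
  assumes "orthonormal_basis e"
  shows "(\<lambda>n. expansion {..<n} e x) \<longlonglongrightarrow> x"
proof -
  have on: "orthonormal_on {..<n} e" for n
    using assms by (auto simp: orthonormal_basis_def orthonormal_on_def)
  have fin: "\<exists>N. z \<in> cspan (e ` {..<N})" if "z \<in> cspan (range e)" for z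
  proof -
    have mono: "cspan (e ` {..<N}) \<subseteq> cspan (e ` {..<max M N})"
      "cspan (e ` {..<M}) \<subseteq> cspan (e ` {..<max M N})" for M N
      by (auto intro!: complex_vector.span_mono)
    show ?thesis
      using that
    proof (induction rule: complex_vector.span_induct)
      case base
      show ?case
        unfolding complex_vector.subspace_def
        using mono
        by (auto intro: complex_vector.span_zero complex_vector.span_scale)
          (meson complex_vector.span_add subsetD)
    next
      case (step z)
      then obtain j where "z = e j" by auto
      then have "z \<in> cspan (e ` {..<Suc j})" by (auto intro: complex_vector.span_base)
      then show ?case ..
    qed
  qed
  show ?thesis
  proof (rule LIMSEQ_I)
    fix \<epsilon> :: real assume "\<epsilon> > 0"
    moreover have "x \<in> closure (cspan (range e))"
      using assms by (simp add: orthonormal_basis_def)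
    ultimately obtain z where z: "z \<in> cspan (range e)" "dist z x < \<epsilon>"
      unfolding closure_approachable by blast
    obtain N where N: "z \<in> cspan (e ` {..<N})" using fin z by blast
    have "norm (expansion {..<n} e x - x) < \<epsilon>" if "n \<ge> N" for n
    proof -
      have "z \<in> cspan (e ` {..<n})"
        using N that complex_vector.span_mono[of "e ` {..<N}" "e ` {..<n}"] by fastforce
      from norm_diff_expansion_le[OF on _ this, of x] z(2) show ?thesis
        by (simp add: dist_norm norm_minus_commute)
    qed
    then show "\<exists>N. \<forall>n\<ge>N. norm (expansion {..<n} e x - x) < \<epsilon>" by blast
  qed
qed

lemma parseval:
  assumes "orthonormal_basis e"
  shows "(\<lambda>j. cinner x (e j) * cinner (e j) y) sums cinner x y"
proof -
  have "(\<lambda>n. cinner (expansion {..<n} e x) y) \<longlonglongrightarrow> cinner x y"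
    by (intro bounded_linear.tendsto[OF bounded_linear_cinner_left] expansion_tendsto assms)
  then show ?thesis
    by (simp add: sums_def expansion_def cinner_sum_left cinner_scaleC_left)
qed

lemma sq_coeffs_eq: "sq_coeffs e v j = cinner v (e j) * cinner (e j) v"
  by (metis sq_coeffs_def complex_norm_square cinner_commute)

lemma sq_coeffs_sums:
  assumes "orthonormal_basis e" "norm v = 1"
  shows "sq_coeffs e v sums 1"
  using parseval[OF assms(1), of v v] assms(2)
  by (simp add: sq_coeffs_eq[abs_def] norm_eq_1_iff_cinner)

section \<open>Orthonormal bases of finite-dimensional subspaces\<close>

lemma orthonormal_on_ident_iff:
  "orthonormal_on B (\<lambda>x. x) \<longleftrightarrow>
     (\<forall>x\<in>B. norm x = 1) \<and> (\<forall>x\<in>B. \<forall>y\<in>B. x \<noteq> y \<longrightarrow> cinner x y = 0)"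
  unfolding orthonormal_on_def norm_eq_1_iff_cinner by auto

lemma orthonormal_set_independent:
  assumes "orthonormal_on B (\<lambda>x. x)"
  shows "complex_vector.independent B"
proof
  assume "complex_vector.dependent B"
  then obtain b where b: "b \<in> B" "b \<in> cspan (B - {b})"
    unfolding complex_vector.dependent_def by blast
  have "cinner b b = 0"
    using assms b(1) by (intro orthogonal_to_span[OF _ b(2)]) (auto simp: orthonormal_on_def)
  with assms b(1) show False by (simp add: orthonormal_on_def)
qed

text \<open>Orthonormal subsets of \<open>S\<close> are independent, hence of size at most \<open>card T\<close>, so among those
  whose members satisfy \<open>Q\<close> there is one of maximal size. If it did not span \<open>S\<close>, the extension
  hypothesis would enlarge it. With \<open>Q\<close> trivial this yields an orthonormal
  basis of \<open>S\<close>; with \<open>Q\<close> saying that the vector is an eigenvector it is the spectral theorem.\<close>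

lemma orthonormal_basis_with_property:
  assumes "finite T" "cspan T = S"
    and extend: "\<And>B. \<lbrakk>finite B; B \<subseteq> S; \<forall>b\<in>B. Q b; \<exists>z\<in>S. z \<noteq> 0 \<and> (\<forall>b\<in>B. cinner z b = 0)\<rbrakk>
      \<Longrightarrow> \<exists>z\<in>S. Q z \<and> norm z = 1 \<and> (\<forall>b\<in>B. cinner z b = 0)"
  obtains s :: "nat \<Rightarrow> 'a::complex_inner" where
    "orthonormal_on {1..cdim S} s" "cspan (s ` {1..cdim S}) = S" "\<forall>i\<in>{1..cdim S}. Q (s i)"
proof -
  define good where "good B \<longleftrightarrow> B \<subseteq> S \<and> (\<forall>b\<in>B. Q b) \<and> orthonormal_on B (\<lambda>x. x)" for B
  have bound: "finite B \<and> card B \<le> card T" if "good B" for B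
    using complex_vector.independent_span_bound[OF assms(1)] orthonormal_set_independent that
    unfolding good_def assms(2) by blast
  have "good {}" by (simp add: good_def orthonormal_on_def)
  then obtain B where B: "good B" and max: "\<And>C. good C \<Longrightarrow> card C \<le> card B"
    using ex_has_greatest_nat[of good "{}" card "Suc (card T)"] bound by (metis less_Suc_eq_le)
  have fin: "finite B" using bound B by blast
  have sub: "csubspace S" using complex_vector.subspace_span assms(2) by blast
  have spanB: "cspan B = S"
  proof
    show "cspan B \<subseteq> S"
      using B sub complex_vector.span_minimal by (auto simp: good_def)
    show "S \<subseteq> cspan B"
    proof
      fix x assume "x \<in> S"
      let ?z = "x - expansion B (\<lambda>x. x) x"
      have p: "expansion B (\<lambda>x. x) x \<in> cspan B"
        using expansion_in_span[of B "\<lambda>x. x" x] by simp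
      then have "?z \<in> S"
        using \<open>cspan B \<subseteq> S\<close> \<open>x \<in> S\<close> sub complex_vector.subspace_diff by blast
      moreover have "\<forall>b\<in>B. cinner ?z b = 0"
        using B fin cinner_expansion[of B "\<lambda>x. x"] by (auto simp: good_def cinner_diff_left)
      moreover have "\<not> (\<exists>z\<in>S. Q z \<and> norm z = 1 \<and> (\<forall>b\<in>B. cinner z b = 0))"
      proof
        assume "\<exists>z\<in>S. Q z \<and> norm z = 1 \<and> (\<forall>b\<in>B. cinner z b = 0)"
        then obtain z where z: "z \<in> S" "Q z" "norm z = 1" "\<And>b. b \<in> B \<Longrightarrow> cinner z b = 0"
          by blast
        have "cinner b z = 0" if "b \<in> B" for b
          using z(4)[OF that] cinner_commute[of b z] by simp
        then have "good (insert z B)"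
          using B z unfolding good_def orthonormal_on_ident_iff by auto
        moreover have "z \<notin> B"
          using z(3) z(4)[of z] by auto
        ultimately show False using max[of "insert z B"] fin by simp
      qed
      ultimately have "?z = 0" using extend[OF fin] B unfolding good_def by blast
      then show "x \<in> cspan B" using p by simp
    qed
  qed
  have card: "cdim S = card B"
    using complex_vector.dim_eq_card[of B S] orthonormal_set_independent B spanB sub
    by (metis good_def complex_vector.span_eq_iff)
  obtain s where s: "bij_betw s {1..cdim S} B"
    using ex_bij_betw_nat_finite_1[OF fin] unfolding card by blast
  show ?thesis
  proof (rule that)
    show "orthonormal_on {1..cdim S} s"
    proof -
      have "s i = s j \<longleftrightarrow> i = j" if "i \<in> {1..cdim S}" "j \<in> {1..cdim S}" for i j
        using s that by (meson bij_betw_def inj_on_eq_iff)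
      moreover have "s i \<in> B" if "i \<in> {1..cdim S}" for i
        using s that by (rule bij_betw_apply)
      ultimately show ?thesis using B unfolding good_def orthonormal_on_def by simp
    qed
    show "cspan (s ` {1..cdim S}) = S"
      using s spanB by (simp add: bij_betw_def)
    show "\<forall>i\<in>{1..cdim S}. Q (s i)"
      using B bij_betw_apply[OF s] by (simp add: good_def)
  qed
qed

lemma finite_dim_orthonormal_basis:
  assumes "\<exists>B. finite B \<and> cspan B = S"
  obtains s :: "nat \<Rightarrow> 'a::complex_inner" where
    "orthonormal_on {1..cdim S} s" "cspan (s ` {1..cdim S}) = S"
proof -
  obtain T where T: "finite T" "cspan T = S" using assms by blast
  show ?thesis
  proof (rule orthonormal_basis_with_property[OF T, of "\<lambda>_. True"])
    fix B assume "\<exists>z\<in>S. z \<noteq> 0 \<and> (\<forall>b\<in>B. cinner z b = 0)"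
    then obtain z where z: "z \<in> S" "z \<noteq> 0" "\<forall>b\<in>B. cinner z b = 0" by blast
    let ?u = "complex_of_real (1 / norm z) *\<^sub>C z"
    have "?u \<in> S" using z(1) T(2) complex_vector.span_scale by blast
    moreover have "norm ?u = 1" using z(2) by (simp add: norm_scaleC norm_divide)
    moreover have "\<forall>b\<in>B. cinner ?u b = 0" using z(3) by (simp add: cinner_scaleC_left)
    ultimately show "\<exists>z\<in>S. True \<and> norm z = 1 \<and> (\<forall>b\<in>B. cinner z b = 0)" by blast
  qed (use that in blast)
qed

section \<open>Diagonalisation of self-adjoint operators\<close>

text \<open>The polydisc spanned by \<open>s k\<close> and the remaining vectors is a continuous image of the closed unit
  disc times the smaller polydisc.\<close>

lemma compact_polydisc:
  fixes s :: "'i \<Rightarrow> 'a::complex_inner"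
  assumes "finite I"
  shows "compact {\<Sum>i\<in>I. c i *\<^sub>C s i | c. \<forall>i\<in>I. cmod (c i) \<le> 1}"
  using assms
proof induction
  case empty
  show ?case by simp
next
  case (insert k I)
  let ?K = "{\<Sum>i\<in>I. c i *\<^sub>C s i | c. \<forall>i\<in>I. cmod (c i) \<le> 1}"
  have "compact ((\<lambda>(c, x). c *\<^sub>C s k + x) ` (cball 0 1 \<times> ?K))"
  proof (intro compact_continuous_image compact_Times insert.IH compact_cball)
    show "continuous_on (cball 0 1 \<times> ?K) (\<lambda>(c, x). c *\<^sub>C s k + x)"
      unfolding case_prod_beta
      by (intro continuous_intros bounded_linear.continuous_on[OF bounded_linear_scaleC_left])
  qed
  also have "(\<lambda>(c, x). c *\<^sub>C s k + x) ` (cball 0 1 \<times> ?K)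
      = {\<Sum>i\<in>insert k I. c i *\<^sub>C s i | c. \<forall>i\<in>insert k I. cmod (c i) \<le> 1}" (is "?L = ?R")
  proof
    show "?L \<subseteq> ?R"
    proof clarsimp
      fix d c assume *: "cmod d \<le> 1" "\<forall>i\<in>I. cmod (c i) \<le> 1"
      have "(\<Sum>i\<in>I. c i *\<^sub>C s i) = (\<Sum>i\<in>I. (c(k := d)) i *\<^sub>C s i)"
        using insert.hyps by (intro sum.cong) auto
      with * insert.hyps
      show "\<exists>c'. d *\<^sub>C s k + (\<Sum>i\<in>I. c i *\<^sub>C s i) = (\<Sum>i\<in>insert k I. c' i *\<^sub>C s i)
          \<and> cmod (c' k) \<le> 1 \<and> (\<forall>i\<in>I. cmod (c' i) \<le> 1)"
        by (intro exI[of _ "c(k := d)"]) auto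
    qed
    show "?R \<subseteq> ?L"
      using insert.hyps by (force simp: image_iff)
  qed
  finally show ?case .
qed

text \<open>The coordinates of a unit vector in an orthonormal basis have modulus at most \<open>1\<close>, so the
  sphere is a closed subset of a polydisc.\<close>

lemma compact_unit_sphere:
  assumes "\<exists>B. finite B \<and> cspan B = S"
  shows "compact {x \<in> S. norm (x::'a::complex_inner) = 1}"
proof -
  obtain s :: "nat \<Rightarrow> 'a" where s: "orthonormal_on {1..cdim S} s" "cspan (s ` {1..cdim S}) = S"
    using finite_dim_orthonormal_basis[OF assms] .
  let ?I = "{1..cdim S}"
  let ?K = "{\<Sum>i\<in>?I. c i *\<^sub>C s i | c. \<forall>i\<in>?I. cmod (c i) \<le> 1}"
  have "?K \<subseteq> S"
  proof clarify
    fix c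
    have "(\<Sum>i\<in>?I. c i *\<^sub>C s i) \<in> cspan (s ` ?I)"
      by (intro complex_vector.span_sum complex_vector.span_scale complex_vector.span_base imageI)
    then show "(\<Sum>i\<in>?I. c i *\<^sub>C s i) \<in> S" by (simp only: s(2))
  qed
  moreover have "x \<in> ?K" if "x \<in> S" "norm x = 1" for x
  proof -
    have "norm (s i) = 1" if "i \<in> ?I" for i
      using s(1) that by (simp add: orthonormal_on_def norm_eq_1_iff_cinner)
    then have "\<forall>i\<in>?I. cmod (cinner x (s i)) \<le> 1"
      using cmod_cinner_le[of x "s _"] that(2) by (metis mult_1)
    moreover have "x = (\<Sum>i\<in>?I. cinner x (s i) *\<^sub>C s i)"
      using expansion_eq_self[OF s(1), of x] that s(2) by (simp add: expansion_def)
    ultimately show ?thesis by (intro CollectI exI[of _ "\<lambda>i. cinner x (s i)"]) simp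
  qed
  ultimately have sphere: "{x \<in> S. norm x = 1} = ?K \<inter> {x. norm x = 1}" by auto
  show ?thesis
    unfolding sphere
    by (intro compact_Int_closed compact_polydisc finite_atLeastAtMost closed_Collect_eq continuous_intros)
qed

text \<open>Let \<open>v\<close> maximise \<open>\<langle>Y x, x\<rangle>\<close> on the unit sphere of \<open>V\<close>, with maximum \<open>\<mu>\<close>. The form
  \<open>\<langle>(\<mu> - Y) x, x\<rangle>\<close> is nonnegative on \<open>V\<close> and vanishes at \<open>v\<close>. Moving from \<open>v\<close> by a small
  negative multiple of \<open>w = (\<mu> - Y) v\<close> would make it negative, unless \<open>w = 0\<close>.\<close>

lemma self_adjoint_has_eigenvector:
  assumes "csubspace V" "compact {x \<in> V. norm x = 1}" "V \<noteq> {0}"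
    and "bounded_clinear Y" "Y ` V \<subseteq> V"
    and self_adjoint: "\<And>x y. cinner (Y x) y = cinner x (Y y)"
  obtains v \<nu> where "v \<in> V" "norm (v::'a::complex_inner) = 1" "Y v = \<nu> *\<^sub>C v"
proof -
  let ?U = "{x \<in> V. norm x = 1}"
  have Y: "bounded_linear Y" using assms(4) by (simp add: bounded_clinear_def)
  have V_scaleR: "t *\<^sub>R x \<in> V" if "x \<in> V" for t x
    using assms(1) that complex_vector.subspace_scale scaleC_of_real by metis
  obtain z where "z \<in> V" "z \<noteq> 0"
    using assms(1,3) complex_vector.subspace_0 by blast
  then have "(1 / norm z) *\<^sub>R z \<in> ?U" using V_scaleR by simp
  moreover have "continuous_on ?U (\<lambda>x. inner (Y x) x)"
    by (intro continuous_intros bounded_linear.continuous_on[OF Y])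
  ultimately obtain v where v: "v \<in> V" "norm v = 1"
    and max: "\<And>y. y \<in> V \<Longrightarrow> norm y = 1 \<Longrightarrow> inner (Y y) y \<le> inner (Y v) v"
    using continuous_attains_sup[OF assms(2)] by blast
  define \<mu> where "\<mu> = inner (Y v) v"
  define w where "w = \<mu> *\<^sub>R v - Y v"
  define c where "c = \<mu> * (norm w)\<^sup>2 - inner (Y w) w"
  have w: "w \<in> V"
    unfolding w_def using v assms(1,5) V_scaleR by (auto intro!: complex_vector.subspace_diff)
  have form_nonneg: "\<mu> * (norm y)\<^sup>2 - inner (Y y) y \<ge> 0" if "y \<in> V" for y
  proof (cases "y = 0")
    case False
    have "inner (Y ((1 / norm y) *\<^sub>R y)) ((1 / norm y) *\<^sub>R y) \<le> \<mu>"
      unfolding \<mu>_def using False that V_scaleR by (intro max) auto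
    then have "inner (Y y) y / (norm y)\<^sup>2 \<le> \<mu>"
      by (simp add: linear_simps[OF Y] power2_eq_square)
    then show ?thesis using False by (simp add: field_simps)
  qed simp
  have sym: "inner (Y x) y = inner x (Y y)" for x y
    using self_adjoint by (simp add: inner_eq_Re_cinner)
  have expand: "\<mu> * (norm (v + t *\<^sub>R w))\<^sup>2 - inner (Y (v + t *\<^sub>R w)) (v + t *\<^sub>R w)
      = 2 * t * (norm w)\<^sup>2 + t\<^sup>2 * c" for t
  proof -
    have "\<mu> * (norm (v + t *\<^sub>R w))\<^sup>2 - inner (Y (v + t *\<^sub>R w)) (v + t *\<^sub>R w)
        = (\<mu> * inner v v - inner (Y v) v)
          + t * (2 * (\<mu> * inner v w) - inner (Y v) w - inner (Y w) v) + t\<^sup>2 * c"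
      unfolding dot_square_norm[symmetric] c_def linear_simps[OF Y]
      by (simp add: inner_add_left inner_add_right inner_commute[of w v]
          algebra_simps power2_eq_square)
    moreover have "inner v v = 1" using v(2) by (simp add: dot_square_norm)
    moreover have "\<mu> * inner v w = inner w w + inner (Y v) w"
      by (simp add: w_def inner_diff_left)
    moreover have "inner (Y w) v = inner (Y v) w"
      by (metis sym inner_commute)
    ultimately show ?thesis
      by (simp add: \<mu>_def[symmetric] dot_square_norm)
  qed
  have "c \<ge> 0" unfolding c_def by (rule form_nonneg[OF w])
  have "norm w = 0"
  proof (rule ccontr)
    assume "norm w \<noteq> 0"
    define a where "a = (norm w)\<^sup>2"
    have "a > 0" using \<open>norm w \<noteq> 0\<close> by (simp add: a_def)
    \<comment> \<open>nearly the minimiser \<open>- a / c\<close> of \<open>2 t a + t\<^sup>2 c\<close>, but meaningful also for \<open>c = 0\<close>\<close>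
    let ?t = "- a / (c + 1)"
    have "v + ?t *\<^sub>R w \<in> V"
      using assms(1) v(1) V_scaleR[OF w] by (rule complex_vector.subspace_add)
    from form_nonneg[OF this] have "0 \<le> 2 * ?t * a + ?t\<^sup>2 * c"
      unfolding expand a_def[symmetric] .
    also have "\<dots> = - (a\<^sup>2 * (c + 2)) / (c + 1)\<^sup>2"
      using \<open>c \<ge> 0\<close> by (simp add: divide_simps power2_eq_square) algebra
    also have "\<dots> < 0"
      using \<open>a > 0\<close> \<open>c \<ge> 0\<close> by (simp add: divide_neg_pos)
    finally show False by simp
  qed
  then have "Y v = complex_of_real \<mu> *\<^sub>C v" by (simp add: w_def scaleC_of_real)
  with v that show ?thesis by blast
qed

text \<open>The orthogonal complement in \<open>S\<close> of a set of eigenvectors is again invariant, and if it is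
  nonzero it contains a further unit eigenvector.\<close>

lemma spectral_theorem_on_subspace:
  fixes Y :: "'a::complex_inner \<Rightarrow> 'a"
  assumes "\<exists>B. finite B \<and> cspan B = S" "bounded_clinear Y" "Y ` S \<subseteq> S"
    and self_adjoint: "\<And>x y. cinner (Y x) y = cinner x (Y y)"
  obtains s :: "nat \<Rightarrow> 'a" where "orthonormal_on {1..cdim S} s" "cspan (s ` {1..cdim S}) = S"
    "\<forall>i\<in>{1..cdim S}. \<exists>\<nu>. Y (s i) = \<nu> *\<^sub>C s i"
proof -
  obtain T where T: "finite T" "cspan T = S" using assms(1) by blast
  have sub: "csubspace S" using complex_vector.subspace_span T(2) by blast
  show ?thesis
  proof (rule orthonormal_basis_with_property[OF T, of "\<lambda>v. \<exists>\<nu>. Y v = \<nu> *\<^sub>C v"])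
    fix B assume B: "\<forall>b\<in>B. \<exists>\<nu>. Y b = \<nu> *\<^sub>C b"
      and z: "\<exists>z\<in>S. z \<noteq> 0 \<and> (\<forall>b\<in>B. cinner z b = 0)"
    define V where "V = {x \<in> S. \<forall>b\<in>B. cinner x b = 0}"
    have V1: "csubspace V"
      using sub unfolding V_def complex_vector.subspace_def
      by (auto simp: cinner_add_left cinner_scaleC_left)
    have V2: "compact {x \<in> V. norm x = 1}"
    proof -
      have "closed (\<Inter>b\<in>B. {x. cinner x b = 0})"
        by (intro closed_INT ballI closed_Collect_eq continuous_on_const
            bounded_linear.continuous_on[OF bounded_linear_cinner_left] continuous_on_id)
      moreover have "{x \<in> V. norm x = 1} = {x \<in> S. norm x = 1} \<inter> (\<Inter>b\<in>B. {x. cinner x b = 0})"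
        by (auto simp: V_def)
      ultimately show ?thesis
        using compact_unit_sphere[OF assms(1)] by (simp add: compact_Int_closed)
    qed
    have V3: "V \<noteq> {0}" using z by (auto simp: V_def)
    have V4: "Y ` V \<subseteq> V"
    proof clarify
      fix x assume x: "x \<in> V"
      have "cinner (Y x) b = 0" if "b \<in> B" for b
        using B x that by (auto simp: self_adjoint V_def cinner_scaleC_right)
      then show "Y x \<in> V" using x assms(3) by (auto simp: V_def)
    qed
    obtain v \<nu> where "v \<in> V" "norm v = 1" "Y v = \<nu> *\<^sub>C v"
      using self_adjoint_has_eigenvector[OF V1 V2 V3 assms(2) V4 self_adjoint] .
    then show "\<exists>z\<in>S. (\<exists>\<nu>. Y z = \<nu> *\<^sub>C z) \<and> norm z = 1 \<and> (\<forall>b\<in>B. cinner z b = 0)"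
      unfolding V_def by blast
  qed (use that in blast)
qed

section \<open>Positive operators and density operators\<close>

text \<open>Polarisation: reality of the form at \<open>x + y\<close> and at \<open>\<i> x + y\<close> determines the imaginary
  and real part of \<open>\<langle>Y x, y\<rangle>\<close> in terms of \<open>\<langle>Y y, x\<rangle>\<close>.\<close>

lemma positive_op_self_adjoint:
  assumes "positive_op Y"
  shows "cinner (Y x) y = cinner x (Y (y::'a::complex_inner))"
proof -
  have lin: "Y (a + b) = Y a + Y b" "Y (c *\<^sub>C a) = c *\<^sub>C Y a" for a b c
    using assms by (auto simp: positive_op_def bounded_clinear_def linear_simps)
  have real: "Im (cinner (Y z) z) = 0" for z
    using assms by (auto simp: positive_op_def complex_nonneg_Reals_iff)
  have "Im (cinner (Y a) b + cinner (Y b) a) = 0" for a b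
    using real[of "a + b"] real[of a] real[of b] by (simp add: lin cinner_add_left cinner_add_right)
  from this[of x y] this[of "\<i> *\<^sub>C x" y] have "cinner (Y x) y = cnj (cinner (Y y) x)"
    by (simp add: lin cinner_scaleC_left cinner_scaleC_right complex_eq_iff)
  then show ?thesis by (metis cinner_commute)
qed

lemma cadjoint_self_adjoint:
  assumes "\<And>x y. cinner (Y x) y = cinner x (Y (y::'a::complex_inner))"
  shows "cadjoint Y = Y"
  unfolding cadjoint_def
proof (rule the_equality)
  fix T assume T: "\<forall>x y. cinner (Y x) y = cinner x (T y)"
  show "T = Y"
  proof
    fix y
    have "cinner (T y) x = cinner (Y y) x" for x
      using T assms by (metis cinner_commute)
    then show "T y = Y y" by (rule cinner_ext)
  qed
qed (use assms in blast)

text \<open>A positive operator is its own absolute value, so it can serve as the witness \<open>R\<close> in the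
  definition of the trace class.\<close>

lemma trace_class_positive_op:
  assumes "positive_op Y" "summable (Diag e Y)"
  shows "trace_class e Y"
  using assms cadjoint_self_adjoint[OF positive_op_self_adjoint[OF assms(1)]]
  unfolding trace_class_def Diag_def positive_op_def by auto

lemma positive_op_rank_one: "positive_op (rank_one v (v::'a::complex_inner))"
  unfolding positive_op_def bounded_clinear_def
proof (intro conjI allI)
  show "bounded_linear (rank_one v v)"
    unfolding rank_one_def
    by (rule bounded_linear_compose[OF bounded_linear_scaleC_left bounded_linear_cinner_left])
  show "rank_one v v (c *\<^sub>C x) = c *\<^sub>C rank_one v v x" for c x
    by (simp add: rank_one_def cinner_scaleC_left scaleC_scaleC)
  show "cinner (rank_one v v x) x \<in> \<real>\<^sub>\<ge>\<^sub>0" for x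
  proof -
    have "cinner (rank_one v v x) x = complex_of_real ((cmod (cinner x v))\<^sup>2)"
      by (metis rank_one_def cinner_scaleC_left complex_norm_square cinner_commute)
    then show ?thesis by simp
  qed
qed

lemma positive_op_combination:
  assumes "positive_op A" "positive_op B" "0 \<le> a" "0 \<le> b"
  shows "positive_op (\<lambda>x. a *\<^sub>R A x + b *\<^sub>R B (x::'a::complex_inner))"
  unfolding positive_op_def bounded_clinear_def
proof (intro conjI allI)
  have A: "bounded_linear A" "\<And>c x. A (c *\<^sub>C x) = c *\<^sub>C A x" "\<And>x. cinner (A x) x \<in> \<real>\<^sub>\<ge>\<^sub>0"
    and B: "bounded_linear B" "\<And>c x. B (c *\<^sub>C x) = c *\<^sub>C B x" "\<And>x. cinner (B x) x \<in> \<real>\<^sub>\<ge>\<^sub>0"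
    using assms by (auto simp: positive_op_def bounded_clinear_def)
  show "bounded_linear (\<lambda>x. a *\<^sub>R A x + b *\<^sub>R B x)"
    by (intro bounded_linear_add bounded_linear_const_scaleR A B)
  show "a *\<^sub>R A (c *\<^sub>C x) + b *\<^sub>R B (c *\<^sub>C x) = c *\<^sub>C (a *\<^sub>R A x + b *\<^sub>R B x)" for c x
    by (simp only: A B scaleC_add_right scaleC_of_real[symmetric] scaleC_scaleC mult.commute)
  show "cinner (a *\<^sub>R A x + b *\<^sub>R B x) x \<in> \<real>\<^sub>\<ge>\<^sub>0" for x
    using A(3)[of x] B(3)[of x] assms
    by (auto simp: cinner_add_left cinner_scaleR_left intro!: nonneg_Reals_add_I nonneg_Reals_mult_I)
qed

lemma positive_op_compression:
  assumes "positive_op A" "bounded_clinear P"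
    and "\<And>x y. cinner (P x) y = cinner x (P (y::'a::complex_inner))"
  shows "positive_op (P \<circ> A \<circ> P)"
  using assms bounded_linear_compose[of P "\<lambda>x. A (P x)"] bounded_linear_compose[of A P]
  by (auto simp: positive_op_def bounded_clinear_def comp_def)

lemma proj_of_orthonormal_span:
  assumes "orthonormal_on I s" "finite I" "cspan (s ` I) = S"
  shows "bounded_clinear (proj S)" "cinner (proj S x) y = cinner x (proj S y)"
    "proj S x \<in> S" "x \<in> S \<Longrightarrow> proj S x = x"
proof -
  note P = proj_eq_expansion[OF assms]
  have "bounded_linear (expansion I s)"
    unfolding expansion_def
    by (intro bounded_linear_sum
        bounded_linear_compose[OF bounded_linear_scaleC_left bounded_linear_cinner_left])
  moreover have "expansion I s (c *\<^sub>C x) = c *\<^sub>C expansion I s x" for c x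
    by (simp add: expansion_def cinner_scaleC_left complex_vector.scale_sum_right
        del: complex_vector.scale_scale flip: scaleC_scaleC)
  ultimately show "bounded_clinear (proj S)"
    by (simp add: bounded_clinear_def P[abs_def])
  show "cinner (proj S x) y = cinner x (proj S y)"
    unfolding P expansion_def cinner_sum_left cinner_sum_right cinner_scaleC_left cinner_scaleC_right
    by (intro sum.cong refl) (metis cinner_commute mult.commute)
  show "proj S x \<in> S" using expansion_in_span assms(3) P by metis
  show "x \<in> S \<Longrightarrow> proj S x = x" using expansion_eq_self[OF assms(1,2)] assms(3) P by metis
qed

text \<open>Self-adjointness and \<open>range Y \<subseteq> S\<close> make \<open>Y\<close> vanish on the orthogonal complement of \<open>S\<close>.
  Hence the eigenbasis of \<open>Y\<close> in \<open>S\<close> gives \<open>Y = \<Sum>\<^sub>i u\<^sub>i (s\<^sub>i \<otimes> s\<^sub>i)\<close> on the whole space, and the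
  diagonal of \<open>s\<^sub>i \<otimes> s\<^sub>i\<close> is \<open>|s\<^sub>i|\<^sup>2\<close>.\<close>

lemma positive_op_Diag_decomposition:
  fixes S :: "'a::chilbert_space set"
  assumes "\<exists>B. finite B \<and> cspan B = S" "positive_op Y" "range Y \<subseteq> S"
  obtains s :: "nat \<Rightarrow> 'a" and u :: "nat \<Rightarrow> real" where
    "orthonormal_on {1..cdim S} s" "s ` {1..cdim S} \<subseteq> S" "\<forall>i\<in>{1..cdim S}. 0 \<le> u i"
    "Diag e Y = (\<lambda>j. \<Sum>i\<in>{1..cdim S}. complex_of_real (u i) * sq_coeffs e (s i) j)"
proof -
  let ?I = "{1..cdim S}"
  note sa = positive_op_self_adjoint[OF assms(2)]
  have Y: "bounded_linear Y" "\<And>c x. Y (c *\<^sub>C x) = c *\<^sub>C Y x" "\<And>x. cinner (Y x) x \<in> \<real>\<^sub>\<ge>\<^sub>0"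
    using assms(2) by (auto simp: positive_op_def bounded_clinear_def)
  have "bounded_clinear Y" "Y ` S \<subseteq> S"
    using assms by (auto simp: positive_op_def)
  from spectral_theorem_on_subspace[OF assms(1) this sa]
  obtain s :: "nat \<Rightarrow> 'a" where s: "orthonormal_on ?I s" "cspan (s ` ?I) = S"
    and eig: "\<forall>i\<in>?I. \<exists>\<nu>. Y (s i) = \<nu> *\<^sub>C s i" .
  define u where "u i = Re (cinner (Y (s i)) (s i))" for i
  have eigval: "Y (s i) = complex_of_real (u i) *\<^sub>C s i" if i: "i \<in> ?I" for i
  proof -
    obtain \<nu> where \<nu>: "Y (s i) = \<nu> *\<^sub>C s i" using eig i by blast
    have "cinner (Y (s i)) (s i) = \<nu>"
      using s(1) i by (simp add: \<nu> cinner_scaleC_left orthonormal_on_def)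
    moreover have "cinner (Y (s i)) (s i) = complex_of_real (u i)"
      using Y(3)[of "s i"] by (simp add: u_def complex_eq_iff complex_nonneg_Reals_iff)
    ultimately show ?thesis using \<nu> by simp
  qed
  have Y_eq: "Y x = (\<Sum>i\<in>?I. cinner x (s i) *\<^sub>C complex_of_real (u i) *\<^sub>C s i)" for x
  proof -
    have "Y (x - expansion ?I s x) = 0"
    proof (rule cinner_ext)
      fix y
      have "Y y \<in> cspan (s ` ?I)" using assms(3) s(2) by auto
      then show "cinner (Y (x - expansion ?I s x)) y = cinner 0 y"
        by (simp only: sa cinner_zero_left diff_expansion_orthogonal[OF s(1) finite_atLeastAtMost])
    qed
    then have "Y x = Y (expansion ?I s x)" by (simp add: linear_simps[OF Y(1)])
    also have "\<dots> = (\<Sum>i\<in>?I. cinner x (s i) *\<^sub>C Y (s i))"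
      unfolding expansion_def
      by (simp add: linear_sum[OF bounded_linear.linear[OF Y(1)]] Y(2))
    finally show ?thesis by (simp only: eigval cong: sum.cong)
  qed
  show ?thesis
  proof (rule that[OF s(1)])
    show "s ` ?I \<subseteq> S" using s(2) complex_vector.span_superset[of "s ` ?I"] by (simp only:)
    show "\<forall>i\<in>?I. 0 \<le> u i"
      using Y(3) by (simp add: u_def complex_nonneg_Reals_iff)
    show "Diag e Y = (\<lambda>j. \<Sum>i\<in>?I. complex_of_real (u i) * sq_coeffs e (s i) j)"
      unfolding Diag_def Y_eq cinner_sum_left cinner_scaleC_left sq_coeffs_eq
      by (simp add: mult_ac)
  qed
qed

lemma Diag_decomposition_sums:
  assumes "orthonormal_basis e" "orthonormal_on I s"
    and "D = (\<lambda>j. \<Sum>i\<in>I. complex_of_real (u i) * sq_coeffs e (s i) j)"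
  shows "D sums complex_of_real (\<Sum>i\<in>I. u i)"
proof -
  have "sq_coeffs e (s i) sums 1" if "i \<in> I" for i
    using assms(2) that
    by (intro sq_coeffs_sums[OF assms(1)]) (simp add: orthonormal_on_def norm_eq_1_iff_cinner)
  then have "D sums (\<Sum>i\<in>I. complex_of_real (u i) * 1)"
    unfolding assms(3) by (intro sums_sum sums_mult)
  then show ?thesis by simp
qed

text \<open>Finite rank makes the diagonal summable. Without this, \<open>op_trace e Y = 1\<close> would say
  nothing, since \<open>suminf\<close> of a divergent series is an unspecified value.\<close>

lemma density_ops_iff:
  assumes "orthonormal_basis e" "\<exists>B. finite B \<and> cspan B = S"
  shows "Y \<in> density_ops e S \<longleftrightarrow> positive_op Y \<and> range Y \<subseteq> S \<and> Diag e Y sums 1"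
proof -
  obtain s where s: "orthonormal_on {1..cdim S} s" "cspan (s ` {1..cdim S}) = S"
    using finite_dim_orthonormal_basis[OF assms(2)] .
  note P = proj_of_orthonormal_span[OF s(1) finite_atLeastAtMost s(2)]
  have range: "proj S \<circ> Y = Y \<longleftrightarrow> range Y \<subseteq> S"
    unfolding fun_eq_iff image_subset_iff comp_apply using P(3,4) by (metis UNIV_I)
  have trace: "op_trace e Y = 1 \<longleftrightarrow> Diag e Y sums 1" if Y: "positive_op Y" "range Y \<subseteq> S"
  proof -
    obtain s u where s: "orthonormal_on {1..cdim S} s"
      and D: "Diag e Y = (\<lambda>j. \<Sum>i\<in>{1..cdim S}. complex_of_real (u i) * sq_coeffs e (s i) j)"
      using positive_op_Diag_decomposition[OF assms(2) Y, of e] .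
    from Diag_decomposition_sums[OF assms(1) s D] have "summable (Diag e Y)"
      by (rule sums_summable)
    then show ?thesis
      unfolding op_trace_def Diag_def by (auto simp: sums_iff)
  qed
  show ?thesis
    unfolding density_ops_def
    using range trace trace_class_positive_op[of Y e] by (auto dest: sums_summable)
qed

section \<open>Descriptions of the moment\<close>

lemma moment_subset_hull_of_frame:
  assumes "orthonormal_basis e" "\<exists>B. finite B \<and> cspan B = S"
  shows "moment e S \<subseteq> (\<Union>s \<in> {s. orthonormal_on {1..cdim S} s \<and> s ` {1..cdim S} \<subseteq> S}.
    convex hull {sq_coeffs e (s i) |i. i \<in> {1..cdim S}})"
proof
  let ?I = "{1..cdim S}"
  fix x assume "x \<in> moment e S"
  then obtain Y where x: "x = Diag e Y" and Y: "positive_op Y" "range Y \<subseteq> S" "Diag e Y sums 1"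
    using density_ops_iff[OF assms] by (auto simp: moment_def)
  obtain s u where s: "orthonormal_on ?I s" "s ` ?I \<subseteq> S" and u: "\<forall>i\<in>?I. 0 \<le> u i"
    and D: "Diag e Y = (\<lambda>j. \<Sum>i\<in>?I. complex_of_real (u i) * sq_coeffs e (s i) j)"
    using positive_op_Diag_decomposition[OF assms(2) Y(1,2), of e] .
  have "complex_of_real (\<Sum>i\<in>?I. u i) = 1"
    using Diag_decomposition_sums[OF assms(1) s(1) D] Y(3) by (rule sums_unique2)
  then have "(\<Sum>i\<in>?I. u i) = 1" by (simp only: of_real_eq_1_iff)
  then have "(\<Sum>i\<in>?I. u i *\<^sub>R sq_coeffs e (s i)) \<in> convex hull {sq_coeffs e (s i) |i. i \<in> ?I}"
    using u by (intro convex_sum convex_convex_hull hull_inc) auto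
  moreover have "(\<Sum>i\<in>J. u i *\<^sub>R sq_coeffs e (s i)) j
      = (\<Sum>i\<in>J. complex_of_real (u i) * sq_coeffs e (s i) j)" for J j
    by (induction J rule: infinite_finite_induct)
      (auto simp: scaleR_fun_def scaleR_conv_of_real)
  then have "(\<Sum>i\<in>?I. u i *\<^sub>R sq_coeffs e (s i)) = x"
    unfolding x D by (rule ext)
  ultimately show "x \<in> (\<Union>s \<in> {s. orthonormal_on ?I s \<and> s ` ?I \<subseteq> S}.
      convex hull {sq_coeffs e (s i) |i. i \<in> ?I})"
    using s by blast
qed

text \<open>\<open>Diag\<close> is linear, and positivity, range in the subspace \<open>S\<close> and trace one pass to convex
  combinations of operators.\<close>

lemma convex_moment:
  assumes "orthonormal_basis e" "\<exists>B. finite B \<and> cspan B = S"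
  shows "convex (moment e S)"
  unfolding convex_def
proof (intro ballI allI impI)
  fix x y and a b :: real
  assume "x \<in> moment e S" "y \<in> moment e S" and ab: "0 \<le> a" "0 \<le> b" "a + b = 1"
  then obtain A B where x: "x = Diag e A" and A: "positive_op A" "range A \<subseteq> S" "Diag e A sums 1"
    and y: "y = Diag e B" and B: "positive_op B" "range B \<subseteq> S" "Diag e B sums 1"
    using density_ops_iff[OF assms] by (auto simp: moment_def)
  let ?C = "\<lambda>x. a *\<^sub>R A x + b *\<^sub>R B x"
  have C: "Diag e ?C = a *\<^sub>R x + b *\<^sub>R y"
    unfolding x y by (auto simp: Diag_def scaleR_fun_def cinner_add_left cinner_scaleR_left
        scaleR_conv_of_real)
  have "csubspace S" using complex_vector.subspace_span assms(2) by blast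
  then have "range ?C \<subseteq> S"
    using A(2) B(2)
    by (auto simp: image_subset_iff simp flip: scaleC_of_real
        intro!: complex_vector.subspace_add complex_vector.subspace_scale)
  moreover have "Diag e ?C sums (a *\<^sub>R 1 + b *\<^sub>R 1)"
    unfolding C x y using sums_add[OF sums_scaleR_right[OF A(3)] sums_scaleR_right[OF B(3)]]
    by (simp add: plus_fun_def scaleR_fun_def)
  ultimately have "?C \<in> density_ops e S"
    using positive_op_combination[OF A(1) B(1) ab(1,2)] ab(3)
    by (simp add: density_ops_iff[OF assms] flip: scaleR_add_left)
  then show "a *\<^sub>R x + b *\<^sub>R y \<in> moment e S"
    unfolding moment_def C[symmetric] by (rule imageI)
qed

lemma sq_coeffs_in_moment:
  assumes "orthonormal_basis e" "\<exists>B. finite B \<and> cspan B = S" "v \<in> S" "norm v = 1"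
  shows "sq_coeffs e v \<in> moment e S"
proof -
  have D: "Diag e (rank_one v v) = sq_coeffs e v"
    by (auto simp: Diag_def rank_one_def sq_coeffs_eq cinner_scaleC_left mult.commute)
  have "csubspace S" using complex_vector.subspace_span assms(2) by blast
  then have "range (rank_one v v) \<subseteq> S"
    using assms(3) by (auto simp: rank_one_def intro: complex_vector.subspace_scale)
  then have "rank_one v v \<in> density_ops e S"
    using positive_op_rank_one sq_coeffs_sums[OF assms(1,4)]
    by (simp add: density_ops_iff[OF assms(1,2)] D)
  then show ?thesis unfolding moment_def D[symmetric] by (rule imageI)
qed

lemma op_trace_basis_projection_comp:
  assumes "orthonormal_basis e"
  shows "op_trace e (rank_one (e j) (e j) \<circ> Y) = Diag e Y j"
proof -
  have "cinner ((rank_one (e j) (e j) \<circ> Y) (e k)) (e k) = (if k = j then Diag e Y j else 0)" for k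
    using assms
    by (simp add: rank_one_def Diag_def cinner_scaleC_left orthonormal_basis_def orthonormal_on_def)
  then show ?thesis
    unfolding op_trace_def using sums_unique[OF sums_single[of j "\<lambda>_. Diag e Y j"]] by simp
qed

text \<open>The operator under the trace is \<open>x \<mapsto> \<langle>x, P e\<^sub>j\<rangle> A P e\<^sub>j\<close>, and Parseval's identity
  evaluates its trace to \<open>\<langle>A P e\<^sub>j, P e\<^sub>j\<rangle>\<close>.\<close>

lemma op_trace_compressed_basis_projection:
  assumes "orthonormal_basis e" "bounded_clinear A" "bounded_clinear P"
    and "\<And>x y. cinner (P x) y = cinner x (P y)"
  shows "op_trace e (A \<circ> (P \<circ> rank_one (e j) (e j) \<circ> P)) = Diag e (P \<circ> A \<circ> P) j"
proof -
  have "cinner ((A \<circ> (P \<circ> rank_one (e j) (e j) \<circ> P)) (e k)) (e k)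
      = cinner (A (P (e j))) (e k) * cinner (e k) (P (e j))" for k
    using assms(2-4) by (simp add: rank_one_def bounded_clinear_def cinner_scaleC_left mult.commute)
  then have "op_trace e (A \<circ> (P \<circ> rank_one (e j) (e j) \<circ> P)) = cinner (A (P (e j))) (P (e j))"
    unfolding op_trace_def using sums_unique[OF parseval[OF assms(1), of "A (P (e j))" "P (e j)"]] by simp
  then show ?thesis using assms(4) by (simp add: Diag_def)
qed

lemma moment_subset_probability_sequences:
  assumes "orthonormal_basis e" "\<exists>B. finite B \<and> cspan B = S"
  shows "moment e S \<subseteq> {x \<in> ell1_real. (\<forall>i. x i \<in> \<real>\<^sub>\<ge>\<^sub>0) \<and> (\<Sum>i. x i) = 1}"
proof
  fix x assume "x \<in> moment e S"
  then obtain Y where x: "x = Diag e Y" and Y: "positive_op Y" "Diag e Y sums 1"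
    using density_ops_iff[OF assms] by (auto simp: moment_def)
  have pos: "x i \<in> \<real>\<^sub>\<ge>\<^sub>0" for i
    using Y(1) by (auto simp: x Diag_def positive_op_def)
  have "norm (x i) = Re (x i)" for i
    using pos[of i] by (auto elim!: nonneg_Reals_cases)
  moreover have "summable (\<lambda>i. Re (x i))"
    using sums_Re[OF Y(2)] by (auto simp: x sums_summable)
  ultimately have "summable (\<lambda>i. norm (x i))" by simp
  then show "x \<in> {x \<in> ell1_real. (\<forall>i. x i \<in> \<real>\<^sub>\<ge>\<^sub>0) \<and> (\<Sum>i. x i) = 1}"
    using pos Y(2) nonneg_Reals_subset_Reals by (auto simp: ell1_real_def sums_iff x)
qed

text \<open>A density operator of \<open>S\<close> equals its own compression to \<open>S\<close>, which gives one inclusion. In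
  the other direction the compression \<open>P \<rho> P\<close> of a state may have trace below \<open>1\<close>; intersecting with
  the sequences of sum \<open>1\<close> keeps those states for which it is a density operator.\<close>

lemma moment_eq_joint_numerical_range:
  assumes "orthonormal_basis e" "\<exists>B. finite B \<and> cspan B = S"
  shows "moment e S = joint_numerical_range e (\<lambda>j. proj S \<circ> rank_one (e j) (e j) \<circ> proj S)
    \<inter> {x \<in> ell1_real. (\<forall>i. x i \<in> \<real>\<^sub>\<ge>\<^sub>0) \<and> (\<Sum>i. x i) = 1}" (is "_ = ?W \<inter> ?L")
proof -
  obtain s where s: "orthonormal_on {1..cdim S} s" "cspan (s ` {1..cdim S}) = S"
    using finite_dim_orthonormal_basis[OF assms(2)] .
  note P = proj_of_orthonormal_span[OF s(1) finite_atLeastAtMost s(2)]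
  have W: "?W = {Diag e (proj S \<circ> \<rho> \<circ> proj S) |\<rho>. trace_class e \<rho> \<and> positive_op \<rho> \<and> op_trace e \<rho> = 1}"
    unfolding joint_numerical_range_def
    using op_trace_compressed_basis_projection[OF assms(1) _ P(1,2)]
    by (intro Collect_cong ex_cong1) (auto simp: positive_op_def)
  have "moment e S \<subseteq> ?W"
  proof
    fix x assume "x \<in> moment e S"
    then obtain Y where x: "x = Diag e Y" and Y: "Y \<in> density_ops e S" by (auto simp: moment_def)
    then have pos: "positive_op Y" and ran: "\<And>z. proj S (Y z) = Y z"
      by (auto simp: density_ops_def fun_eq_iff)
    have "(proj S \<circ> Y \<circ> proj S) z = Y z" for z
    proof (rule cinner_ext)
      fix y
      have "cinner ((proj S \<circ> Y \<circ> proj S) z) y = cinner z (proj S (Y y))"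
        by (simp add: ran P(2) positive_op_self_adjoint[OF pos])
      then show "cinner ((proj S \<circ> Y \<circ> proj S) z) y = cinner (Y z) y"
        by (simp add: ran positive_op_self_adjoint[OF pos])
    qed
    then have "x = Diag e (proj S \<circ> Y \<circ> proj S)" by (simp add: x Diag_def)
    then show "x \<in> ?W" using Y unfolding W density_ops_def by blast
  qed
  moreover have "x \<in> moment e S" if x_W: "x \<in> ?W" and x_L: "x \<in> ?L" for x
  proof -
    obtain \<rho> where x: "x = Diag e (proj S \<circ> \<rho> \<circ> proj S)" and "positive_op \<rho>"
      using x_W unfolding W by blast
    then have "positive_op (proj S \<circ> \<rho> \<circ> proj S)" by (intro positive_op_compression P)
    moreover have "range (proj S \<circ> \<rho> \<circ> proj S) \<subseteq> S" using P(3) by auto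
    moreover have "x sums 1"
      using x_L summable_norm_cancel[of x] by (auto simp: ell1_real_def sums_iff)
    ultimately have "proj S \<circ> \<rho> \<circ> proj S \<in> density_ops e S"
      unfolding density_ops_iff[OF assms] x by blast
    then show ?thesis unfolding moment_def x by (rule imageI)
  qed
  ultimately show ?thesis using moment_subset_probability_sequences[OF assms] by blast
qed

theorem proposition1:
  fixes e :: "nat \<Rightarrow> 'a::chilbert_space" and S :: "'a set" and r :: nat
  assumes "orthonormal_basis e"
    and "csubspace S"
    and "\<exists>B. finite B \<and> cspan B = S"
    and "cdim S = r"
  shows "moment e S = Diag e ` density_ops e S
    \<and> moment e S = convex hull {sq_coeffs e v |v. v \<in> S \<and> norm v = 1}
    \<and> moment e S = (\<Union>s \<in> {s. orthonormal_on {1..r} s \<and> s ` {1..r} \<subseteq> S}.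
                       convex hull {sq_coeffs e (s i) |i. i \<in> {1..r}})
    \<and> moment e S = {(\<lambda>j. op_trace e (rank_one (e j) (e j) \<circ> Y)) |Y. Y \<in> density_ops e S}
    \<and> moment e S = joint_numerical_range e (\<lambda>j. proj S \<circ> rank_one (e j) (e j) \<circ> proj S)
                     \<inter> {x \<in> ell1_real. (\<forall>i. x i \<in> \<real>\<^sub>\<ge>\<^sub>0) \<and> (\<Sum>i. x i) = 1}
    \<and> moment e S \<subseteq> ell1_real"
proof -
  let ?b = "convex hull {sq_coeffs e v |v. v \<in> S \<and> norm v = 1}"
  let ?c = "\<Union>s \<in> {s. orthonormal_on {1..r} s \<and> s ` {1..r} \<subseteq> S}.
    convex hull {sq_coeffs e (s i) |i. i \<in> {1..r}}"
  have "moment e S \<subseteq> ?c"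
    using moment_subset_hull_of_frame[OF assms(1,3)] by (simp only: assms(4))
  moreover have "?c \<subseteq> ?b"
  proof (intro UN_least hull_mono subsetI)
    fix s x assume s: "s \<in> {s. orthonormal_on {1..r} s \<and> s ` {1..r} \<subseteq> S}"
      and "x \<in> {sq_coeffs e (s i) |i. i \<in> {1..r}}"
    then obtain i where "i \<in> {1..r}" "x = sq_coeffs e (s i)" by blast
    moreover from this s have "s i \<in> S" "norm (s i) = 1"
      by (auto simp: orthonormal_on_def norm_eq_1_iff_cinner)
    ultimately show "x \<in> {sq_coeffs e v |v. v \<in> S \<and> norm v = 1}" by blast
  qed
  moreover have "?b \<subseteq> moment e S"
    using sq_coeffs_in_moment[OF assms(1,3)] convex_moment[OF assms(1,3)]
    by (intro hull_minimal) auto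
  ultimately have "moment e S = ?b" "moment e S = ?c" by auto
  moreover have "moment e S = {(\<lambda>j. op_trace e (rank_one (e j) (e j) \<circ> Y)) |Y. Y \<in> density_ops e S}"
    unfolding op_trace_basis_projection_comp[OF assms(1)] by (auto simp: moment_def)
  moreover have "moment e S \<subseteq> ell1_real"
    using moment_subset_probability_sequences[OF assms(1,3)] by blast
  ultimately show ?thesis
    using moment_eq_joint_numerical_range[OF assms(1,3)] by (simp only: moment_def)
qed

end
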